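(* Let $w\in W$ with a fixed reduced decomposition $w=s_{i_1}\cdots s_{i_t}$ and let $\Delta\subseteq\{1,\dots,t\}$ be any subset. Let $\Psi:\ker(w+w^\Delta)\to\ker(M(w^\Delta))$ be defined by $$\Psi(\gamma)=\sum_{h=1}^m\langle(\beta_{t_h}^\Delta)^\vee|w^\Delta(\gamma)\rangle\,\boldsymbol{e}_h,$$ and let $\Phi:\mathbb{Q}^m\to V$ be the linear map defined by $\Phi(\boldsymbol e_h)=\frac12(w^\Delta)^{-1}(\beta_{t_h})$ for $h=1,\dots,m$. Then $\Phi$ restricts to a linear map $\tilde\Phi:\ker(M(w^\Delta))\to\ker(w+w^\Delta)$, and $$\Psi\circ\tilde\Phi=\mathrm{id}|_{\ker(M(w^\Delta))}\quad\text{and}\quad\tilde\Phi\circ\Psi=\mathrm{id}|_{\ker(w+w^\Delta)}.$$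
   Context: $\mathfrak g$ is a simple complex Lie algebra of rank $n$ with simple roots $\alpha_1,\dots,\alpha_n$, a basis of a Euclidean space with $W$-invariant inner product $\langle\cdot|\cdot\rangle$ normalised so that short roots have length $\sqrt2$; $W$ is the Weyl group, generated by the simple reflections $s_i=s_{\alpha_i}$. For a root $\alpha$, $\alpha^\vee=2\alpha/\langle\alpha|\alpha\rangle$; the fundamental weights $\varpi_j$ are defined by $\langle\varpi_j|\alpha_i^\vee\rangle=\delta_{ij}$; $V=\bigoplus_{i=1}^n\mathbb{Q}\varpi_i$, on which $W$ acts. For $w=s_{i_1}\cdots s_{i_t}$ reduced ($t=l(w)$), put $\beta_k=s_{i_1}\cdots s_{i_{k-1}}(\alpha_{i_k})$ for $1\le k\le t$. For $\Delta\subseteq\{1,\dots,t\}$ write $\{t_1<\cdots<t_m\}=\{1,\dots,t\}\setminus\Delta$; put $s_{i_k}^\Delta=s_{i_k}$ if $k\in\Delta$ and $s_{i_k}^\Delta=\mathrm{id}$ otherwise, $w^\Delta=s_{i_1}^\Delta\cdots s_{i_t}^\Delta\in W$, and $\beta_k^\Delta=s_{i_1}^\Delta\cdots s_{i_{k-1}}^\Delta(\alpha_{i_k})$ (so $\beta_1^\Delta=\alpha_{i_1}$). $M(w^\Delta)$ is the $m\times m$ skew-symmetric matrix whose $(i,\ell)$-entry, for $i<\ell$, is $\langle\beta_{t_i}|\beta_{t_\ell}\rangle$, regarded as a linear map $\mathbb{Q}^m\to\mathbb{Q}^m$; $w+w^\Delta$ is regarded as a linear map $V\to V$. $\boldsymbol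 e_1,\dots,\boldsymbol e_m$ is the standard basis of $\mathbb{Q}^m$. *)

theory Defs
  imports "HOL-Analysis.Euclidean_Space" "Jordan_Normal_Form.Matrix_Kernel"
begin

text \<open>
  A simple complex Lie algebra of rank \<open>n\<close> with chosen simple roots is represented by its
  root system \<open>R\<close> (finite, crystallographic, reduced, irreducible) in a Euclidean space,
  together with a base \<open>\<alpha> 1, \<dots>, \<alpha> n\<close> of \<open>R\<close>. The inner product of the ambient Euclidean
  space is automatically invariant under the Weyl group, which is generated by orthogonal
  reflections.
\<close>

definition coroot :: "'a::euclidean_space \<Rightarrow> 'a" where
  "coroot a = (2 / inner a a) *\<^sub>R a"

definition reflection :: "'a::euclidean_space \<Rightarrow> 'a \<Rightarrow> 'a" where
  "reflection a x = x - inner x (coroot a) *\<^sub>R a"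

definition root_system :: "'a::euclidean_space set \<Rightarrow> bool" where
  "root_system R \<longleftrightarrow>
     finite R \<and> 0 \<notin> R \<and> span R = UNIV \<and>
     (\<forall>a\<in>R. reflection a ` R = R) \<and>
     (\<forall>a\<in>R. \<forall>b\<in>R. inner b (coroot a) \<in> \<int>) \<and>
     (\<forall>a\<in>R. \<forall>c. c *\<^sub>R a \<in> R \<longrightarrow> c = 1 \<or> c = - 1)"

definition irreducible_root_system :: "'a::euclidean_space set \<Rightarrow> bool" where
  "irreducible_root_system R \<longleftrightarrow>
     root_system R \<and> R \<noteq> {} \<and>
     \<not> (\<exists>A B. A \<noteq> {} \<and> B \<noteq> {} \<and> A \<union> B = R \<and> A \<inter> B = {} \<and>
              (\<forall>a\<in>A. \<forall>b\<in>B. inner a b = 0))"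

definition simple_roots ::
    "'a::euclidean_space set \<Rightarrow> nat \<Rightarrow> (nat \<Rightarrow> 'a) \<Rightarrow> bool" where
  "simple_roots R n \<alpha> \<longleftrightarrow>
     inj_on \<alpha> {1..n} \<and> \<alpha> ` {1..n} \<subseteq> R \<and>
     independent (\<alpha> ` {1..n}) \<and> span (\<alpha> ` {1..n}) = UNIV \<and>
     (\<forall>r\<in>R. \<exists>c :: nat \<Rightarrow> nat.
        r = (\<Sum>i=1..n. real (c i) *\<^sub>R \<alpha> i) \<or> r = - (\<Sum>i=1..n. real (c i) *\<^sub>R \<alpha> i))"

text \<open>
  The short roots are the roots of minimal length; if all roots have the same length, then
  all of them are short.
\<close>
definition short_roots_normalised :: "'a::euclidean_space set \<Rightarrow> bool" where
  "short_roots_normalised R \<longleftrightarrow> Min (norm ` R) = sqrt 2"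

inductive_set weyl_group :: "nat \<Rightarrow> (nat \<Rightarrow> 'a::euclidean_space) \<Rightarrow> ('a \<Rightarrow> 'a) set"
  for n :: nat and \<alpha> :: "nat \<Rightarrow> 'a" where
  weyl_id: "id \<in> weyl_group n \<alpha>"
| weyl_gen: "i \<in> {1..n} \<Longrightarrow> reflection (\<alpha> i) \<in> weyl_group n \<alpha>"
| weyl_comp: "u \<in> weyl_group n \<alpha> \<Longrightarrow> v \<in> weyl_group n \<alpha> \<Longrightarrow> u \<circ> v \<in> weyl_group n \<alpha>"
| weyl_inv: "u \<in> weyl_group n \<alpha> \<Longrightarrow> inv_into UNIV u \<in> weyl_group n \<alpha>"

text \<open>
  A word is given by its letters \<open>i 1, \<dots>, i t\<close>. The set \<open>\<Delta>\<close> holds the positions that are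
  kept; \<open>sub_prod \<alpha> i \<Delta> k\<close> is the product of the first \<open>k\<close> factors, those at positions
  outside \<open>\<Delta>\<close> being replaced by the identity.
\<close>

primrec word_prod :: "(nat \<Rightarrow> 'a::euclidean_space) \<Rightarrow> (nat \<Rightarrow> nat) \<Rightarrow> nat \<Rightarrow> 'a \<Rightarrow> 'a" where
  "word_prod \<alpha> i 0 = id"
| "word_prod \<alpha> i (Suc k) = word_prod \<alpha> i k \<circ> reflection (\<alpha> (i (Suc k)))"

primrec sub_prod ::
    "(nat \<Rightarrow> 'a::euclidean_space) \<Rightarrow> (nat \<Rightarrow> nat) \<Rightarrow> nat set \<Rightarrow> nat \<Rightarrow> 'a \<Rightarrow> 'a" where
  "sub_prod \<alpha> i \<Delta> 0 = id"
| "sub_prod \<alpha> i \<Delta> (Suc k) =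
     sub_prod \<alpha> i \<Delta> k \<circ> (if Suc k \<in> \<Delta> then reflection (\<alpha> (i (Suc k))) else id)"

definition weyl_length :: "nat \<Rightarrow> (nat \<Rightarrow> 'a::euclidean_space) \<Rightarrow> ('a \<Rightarrow> 'a) \<Rightarrow> nat" where
  "weyl_length n \<alpha> w = (LEAST t. \<exists>i. (\<forall>k\<in>{1..t}. i k \<in> {1..n}) \<and> w = word_prod \<alpha> i t)"

definition reduced_decomposition ::
    "nat \<Rightarrow> (nat \<Rightarrow> 'a::euclidean_space) \<Rightarrow> ('a \<Rightarrow> 'a) \<Rightarrow> (nat \<Rightarrow> nat) \<Rightarrow> nat \<Rightarrow> bool" where
  "reduced_decomposition n \<alpha> w i t \<longleftrightarrow>
     (\<forall>k\<in>{1..t}. i k \<in> {1..n}) \<and> w = word_prod \<alpha> i t \<and> t = weyl_length n \<alpha> w"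

text \<open>Positions are counted from \<open>1\<close>, so the next two definitions are meant for \<open>k \<ge> 1\<close>.\<close>

definition root_seq :: "(nat \<Rightarrow> 'a::euclidean_space) \<Rightarrow> (nat \<Rightarrow> nat) \<Rightarrow> nat \<Rightarrow> 'a" where
  "root_seq \<alpha> i k = word_prod \<alpha> i (k - 1) (\<alpha> (i k))"

definition sub_root_seq ::
    "(nat \<Rightarrow> 'a::euclidean_space) \<Rightarrow> (nat \<Rightarrow> nat) \<Rightarrow> nat set \<Rightarrow> nat \<Rightarrow> 'a" where
  "sub_root_seq \<alpha> i \<Delta> k = sub_prod \<alpha> i \<Delta> (k - 1) (\<alpha> (i k))"

text \<open>
  The deleted positions \<open>t\<^sub>1 < \<dots> < t\<^sub>m\<close>. Vectors and matrices are indexed from \<open>0\<close>, so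
  \<open>deleted_pos t \<Delta> h\<close> with \<open>h < m\<close> is \<open>t\<^sub>h\<^sub>+\<^sub>1\<close>.
\<close>

definition num_deleted :: "nat \<Rightarrow> nat set \<Rightarrow> nat" where
  "num_deleted t \<Delta> = card ({1..t} - \<Delta>)"

definition deleted_pos :: "nat \<Rightarrow> nat set \<Rightarrow> nat \<Rightarrow> nat" where
  "deleted_pos t \<Delta> h = sorted_list_of_set ({1..t} - \<Delta>) ! h"

text \<open>
  The rational vector spaces are realised inside real ones: \<open>rat_vecs m\<close> is \<open>\<rat>\<^sup>m\<close> inside
  \<open>\<real>\<^sup>m\<close>, and \<open>rat_weight_space\<close> is the rational span of the (real linearly independent)
  fundamental weights.
\<close>

definition fundamental_weights ::
    "nat \<Rightarrow> (nat \<Rightarrow> 'a::euclidean_space) \<Rightarrow> (nat \<Rightarrow> 'a) \<Rightarrow> bool" where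
  "fundamental_weights n \<alpha> \<omega> \<longleftrightarrow>
     (\<forall>i\<in>{1..n}. \<forall>j\<in>{1..n}. inner (\<omega> j) (coroot (\<alpha> i)) = (if i = j then 1 else 0))"

definition rat_weight_space :: "nat \<Rightarrow> (nat \<Rightarrow> 'a::euclidean_space) \<Rightarrow> 'a set" where
  "rat_weight_space n \<omega> = {\<Sum>j=1..n. q j *\<^sub>R \<omega> j | q. \<forall>j\<in>{1..n}. q j \<in> \<rat>}"

definition rat_vecs :: "nat \<Rightarrow> real vec set" where
  "rat_vecs m = {v \<in> carrier_vec m. \<forall>h<m. v $ h \<in> \<rat>}"

definition rat_linear_map ::
    "(real \<Rightarrow> 'b::plus \<Rightarrow> 'b) \<Rightarrow> (real \<Rightarrow> 'c::plus \<Rightarrow> 'c) \<Rightarrow> 'b set \<Rightarrow> 'c set \<Rightarrow> ('b \<Rightarrow> 'c) \<Rightarrow> bool" where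
  "rat_linear_map scaleS scaleT S T f \<longleftrightarrow>
     (\<forall>x\<in>S. f x \<in> T) \<and>
     (\<forall>x\<in>S. \<forall>y\<in>S. f (x + y) = f x + f y) \<and>
     (\<forall>q\<in>\<rat>. \<forall>x\<in>S. f (scaleS q x) = scaleT q (f x))"

definition skew_mat ::
    "(nat \<Rightarrow> 'a::euclidean_space) \<Rightarrow> (nat \<Rightarrow> nat) \<Rightarrow> nat \<Rightarrow> nat set \<Rightarrow> real mat" where
  "skew_mat \<alpha> i t \<Delta> = mat (num_deleted t \<Delta>) (num_deleted t \<Delta>) (\<lambda>(h, l).
     let b = \<lambda>k. root_seq \<alpha> i (deleted_pos t \<Delta> k)
     in if h < l then inner (b h) (b l)
        else if l < h then - inner (b l) (b h)
        else 0)"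

definition ker_skew ::
    "(nat \<Rightarrow> 'a::euclidean_space) \<Rightarrow> (nat \<Rightarrow> nat) \<Rightarrow> nat \<Rightarrow> nat set \<Rightarrow> real vec set" where
  "ker_skew \<alpha> i t \<Delta> = mat_kernel (skew_mat \<alpha> i t \<Delta>) \<inter> rat_vecs (num_deleted t \<Delta>)"

definition ker_sum ::
    "nat \<Rightarrow> (nat \<Rightarrow> 'a::euclidean_space) \<Rightarrow> ('a \<Rightarrow> 'a) \<Rightarrow> ('a \<Rightarrow> 'a) \<Rightarrow> 'a set" where
  "ker_sum n \<omega> u v = {\<gamma> \<in> rat_weight_space n \<omega>. u \<gamma> + v \<gamma> = 0}"

definition Psi ::
    "(nat \<Rightarrow> 'a::euclidean_space) \<Rightarrow> (nat \<Rightarrow> nat) \<Rightarrow> nat \<Rightarrow> nat set \<Rightarrow> 'a \<Rightarrow> real vec" where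
  "Psi \<alpha> i t \<Delta> \<gamma> = vec (num_deleted t \<Delta>) (\<lambda>h.
     inner (coroot (sub_root_seq \<alpha> i \<Delta> (deleted_pos t \<Delta> h))) (sub_prod \<alpha> i \<Delta> t \<gamma>))"

definition Phi ::
    "(nat \<Rightarrow> 'a::euclidean_space) \<Rightarrow> (nat \<Rightarrow> nat) \<Rightarrow> nat \<Rightarrow> nat set \<Rightarrow> real vec \<Rightarrow> 'a" where
  "Phi \<alpha> i t \<Delta> v = (\<Sum>h<num_deleted t \<Delta>.
     v $ h *\<^sub>R ((1 / 2) *\<^sub>R
       inv_into UNIV (sub_prod \<alpha> i \<Delta> t) (root_seq \<alpha> i (deleted_pos t \<Delta> h))))"

end

theory Submission
  imports Defs "HOL-Analysis.Linear_Algebra"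
begin

text \<open>
  Write \<open>W\<^sub>k\<close> and \<open>S\<^sub>k\<close> for the products of the first \<open>k\<close> factors of \<open>w\<close> and of \<open>w\<^sub>\<Delta>\<close>, and let
  \<open>b\<^sub>1, \<dots>, b\<^sub>m\<close> be the roots \<open>\<beta>\<^sub>k\<close> at the deleted positions. Passing from \<open>k - 1\<close> to \<open>k\<close> leaves
  \<open>W\<^sub>k S\<^sub>k\<^sup>-\<^sup>1\<close> unchanged when position \<open>k\<close> is kept, and multiplies it on the left by the reflection in
  \<open>\<beta>\<^sub>k\<close> when it is deleted. Each reflection subtracts a multiple of its root, and that
  multiple turns out to be \<open>\<langle>(\<beta>\<^sub>k\<^sup>\<Delta>)\<^sup>\<or> | x\<rangle>\<close>. Hence, with \<open>x = w\<^sub>\<Delta> \<gamma>\<close> and \<open>c = \<Psi>(\<gamma>)\<close>,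
  \<open>w \<gamma> = x - \<Sum>\<^sub>h c\<^sub>h b\<^sub>h\<close> and \<open>c\<^sub>h = \<langle>b\<^sub>h\<^sup>\<or> | x - \<Sum>\<^sub>j\<^sub><\<^sub>h c\<^sub>j b\<^sub>j\<rangle>\<close>
  (lemmas \<open>word_prod_inv_sub_prod\<close> and \<open>inner_coroot_sub_root_seq\<close>).

  So \<open>\<gamma>\<close> lies in the kernel of \<open>w + w\<^sub>\<Delta>\<close> exactly when \<open>x = 1/2 \<Sum>\<^sub>h c\<^sub>h b\<^sub>h\<close>, which says
  \<open>\<Phi>(\<Psi>(\<gamma>)) = \<gamma>\<close>. For any vector of the form \<open>x = 1/2 \<Sum>\<^sub>h v\<^sub>h b\<^sub>h\<close>, moreover,
  \<open>\<langle>b\<^sub>h\<^sup>\<or> | x - \<Sum>\<^sub>j\<^sub><\<^sub>h v\<^sub>j b\<^sub>j\<rangle>\<close> differs from \<open>v\<^sub>h\<close> by \<open>(M v)\<^sub>h\<close> divided by \<open>\<langle>b\<^sub>h | b\<^sub>h\<rangle>\<close>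
  (lemma \<open>inner_coroot_half_sum\<close>): subtracting the terms below \<open>h\<close> from half the sum turns
  their sign around, which is the skew-symmetry of \<open>M\<close>. Comparing this with the recursion for
  \<open>c\<close> shows that \<open>v\<close> satisfies the recursion exactly when \<open>M v = 0\<close>, and the recursion
  determines its solution. This gives the remaining two claims on \<open>\<Psi>\<close> and \<open>\<Phi>\<close>.

  What is left is rationality. The space \<open>V\<close> consists of the vectors whose inner products with the
  simple coroots are rational, and it contains all roots and is stable under the Weyl group. The
  entries of \<open>M\<close> are rational because inner products of roots are
  (lemma \<open>inner_roots_rational\<close>); this is where irreducibility and the normalisation of the
  short roots enter.
\<close>

section \<open>Reflections and the products along a word\<close>

lemma orthogonal_transformation_reflection: "orthogonal_transformation (reflection a)"
  unfolding orthogonal_transformation_def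
proof (intro conjI allI)
  show "linear (reflection a)"
    by (rule linearI) (simp_all add: reflection_def algebra_simps)
  show "inner (reflection a x) (reflection a y) = inner x y" for x y
    by (cases "a = 0")
      (simp_all add: reflection_def coroot_def inner_diff_left inner_diff_right inner_commute field_simps)
qed

lemma reflection_involution [simp]: "reflection a (reflection a x) = x"
  by (cases "a = 0") (simp_all add: reflection_def coroot_def inner_diff_left)

lemma inv_reflection: "inv_into UNIV (reflection a) = reflection a"
  by (rule inv_unique_comp) (simp_all add: fun_eq_iff)

lemma coroot_orthogonal_transformation:
  "orthogonal_transformation f \<Longrightarrow> coroot (f a) = f (coroot a)"
  by (simp add: coroot_def orthogonal_transformation_def linear_cmul)

lemma reflection_orthogonal_transformation:
  assumes "orthogonal_transformation f"
  shows "reflection (f a) (f x) = f (reflection a x)"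
  using assms
  by (simp add: reflection_def coroot_orthogonal_transformation orthogonal_transformation_def
      linear_diff linear_cmul)

lemma orthogonal_transformation_word_prod: "orthogonal_transformation (word_prod \<alpha> i k)"
proof (induction k)
  case 0
  then show ?case using orthogonal_transformation_id by (simp add: id_def)
next
  case (Suc k)
  then show ?case
    unfolding word_prod.simps
    by (intro orthogonal_transformation_compose orthogonal_transformation_reflection)
qed

lemma orthogonal_transformation_sub_prod: "orthogonal_transformation (sub_prod \<alpha> i \<Delta> k)"
proof (induction k)
  case 0
  then show ?case using orthogonal_transformation_id by (simp add: id_def)
next
  case (Suc k)
  then show ?case
    unfolding sub_prod.simps
    using orthogonal_transformation_compose[OF Suc orthogonal_transformation_reflection]
    by (cases "Suc k \<in> \<Delta>") (simp_all only: if_True if_False o_id)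
qed

lemma sub_prod_inv [simp]: "sub_prod \<alpha> i \<Delta> k (inv_into UNIV (sub_prod \<alpha> i \<Delta> k) x) = x"
  by (simp add: orthogonal_transformation_sub_prod orthogonal_transformation_surj surj_f_inv_f)

lemma inv_sub_prod [simp]: "inv_into UNIV (sub_prod \<alpha> i \<Delta> k) (sub_prod \<alpha> i \<Delta> k x) = x"
  by (simp add: orthogonal_transformation_sub_prod orthogonal_transformation_inj)

lemma inv_sub_prod_Suc:
  "inv_into UNIV (sub_prod \<alpha> i \<Delta> (Suc k)) x =
     (if Suc k \<in> \<Delta> then reflection (\<alpha> (i (Suc k))) else id) (inv_into UNIV (sub_prod \<alpha> i \<Delta> k) x)"
  using o_inv_distrib[OF
      orthogonal_transformation_bij[OF orthogonal_transformation_sub_prod[of \<alpha> i \<Delta> k]]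
      orthogonal_transformation_bij[OF orthogonal_transformation_reflection[of "\<alpha> (i (Suc k))"]]]
  by (simp add: inv_reflection)

lemma inner_coroot_sub_root_seq_pullback:
  "inner (coroot (sub_root_seq \<alpha> i \<Delta> k)) x =
   inner (coroot (\<alpha> (i k))) (inv_into UNIV (sub_prod \<alpha> i \<Delta> (k - 1)) x)"
proof -
  let ?S = "sub_prod \<alpha> i \<Delta> (k - 1)"
  have "inner (coroot (sub_root_seq \<alpha> i \<Delta> k)) x =
      inner (?S (coroot (\<alpha> (i k)))) (?S (inv_into UNIV ?S x))"
    by (simp add: sub_root_seq_def coroot_orthogonal_transformation orthogonal_transformation_sub_prod)
  also have "\<dots> = inner (coroot (\<alpha> (i k))) (inv_into UNIV ?S x)"
    using orthogonal_transformation_sub_prod unfolding orthogonal_transformation_def by blast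
  finally show ?thesis .
qed

lemma inner_coroot_root_seq_word_prod:
  "inner (coroot (root_seq \<alpha> i k)) (word_prod \<alpha> i (k - 1) y) = inner (coroot (\<alpha> (i k))) y"
  using orthogonal_transformation_word_prod[of \<alpha> i "k - 1"]
  by (simp add: root_seq_def coroot_orthogonal_transformation) (simp add: orthogonal_transformation_def)

text \<open>
  A kept position cancels its reflection against the same one in \<open>S\<^sub>k\<^sup>-\<^sup>1\<close>; at a deleted position,
  conjugating by \<open>W\<^sub>k\<^sub>-\<^sub>1\<close> turns the surplus simple reflection into the reflection in \<open>\<beta>\<^sub>k\<close>.
\<close>
lemma word_prod_inv_sub_prod:
  "word_prod \<alpha> i k (inv_into UNIV (sub_prod \<alpha> i \<Delta> k) x) =
   x - (\<Sum>j\<in>{1..k} - \<Delta>. inner (coroot (sub_root_seq \<alpha> i \<Delta> j)) x *\<^sub>R root_seq \<alpha> i j)"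
proof (induction k)
  case 0
  then show ?case by (simp add: inv_id)
next
  case (Suc k)
  let ?y = "word_prod \<alpha> i k (inv_into UNIV (sub_prod \<alpha> i \<Delta> k) x)"
  show ?case
  proof (cases "Suc k \<in> \<Delta>")
    case True
    then have "{1..Suc k} - \<Delta> = {1..k} - \<Delta>"
      by (auto simp: le_Suc_eq)
    then show ?thesis using True Suc by (simp add: inv_sub_prod_Suc del: sub_prod.simps)
  next
    case False
    then have set_eq: "{1..Suc k} - \<Delta> = insert (Suc k) ({1..k} - \<Delta>)"
      by (auto simp: le_Suc_eq)
    have "word_prod \<alpha> i (Suc k) (inv_into UNIV (sub_prod \<alpha> i \<Delta> (Suc k)) x) = reflection (root_seq \<alpha> i (Suc k)) ?y"
      using False
      by (simp add: inv_sub_prod_Suc root_seq_def reflection_orthogonal_transformation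
          orthogonal_transformation_word_prod del: sub_prod.simps)
    also have "\<dots> = ?y - inner (coroot (sub_root_seq \<alpha> i \<Delta> (Suc k))) x *\<^sub>R root_seq \<alpha> i (Suc k)"
      using inner_coroot_sub_root_seq_pullback[of \<alpha> i \<Delta> "Suc k" x]
        inner_coroot_root_seq_word_prod[of \<alpha> i "Suc k" "inv_into UNIV (sub_prod \<alpha> i \<Delta> k) x"]
      by (simp add: reflection_def inner_commute)
    finally show ?thesis
      unfolding Suc set_eq by (simp add: algebra_simps del: word_prod.simps sub_prod.simps)
  qed
qed

text \<open>
  Both sides equal the pairing of the simple coroot at position \<open>k\<close> with \<open>S\<^sub>k\<^sub>-\<^sub>1\<^sup>-\<^sup>1 x\<close>: the isometry
  \<open>S\<^sub>k\<^sub>-\<^sub>1\<close> carries it to the left side, the isometry \<open>W\<^sub>k\<^sub>-\<^sub>1\<close> to the right side.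
\<close>
lemma inner_coroot_sub_root_seq:
  "inner (coroot (sub_root_seq \<alpha> i \<Delta> k)) x =
   inner (coroot (root_seq \<alpha> i k))
     (x - (\<Sum>j\<in>{1..k - 1} - \<Delta>. inner (coroot (sub_root_seq \<alpha> i \<Delta> j)) x *\<^sub>R root_seq \<alpha> i j))"
  unfolding word_prod_inv_sub_prod[symmetric] inner_coroot_root_seq_word_prod
  by (rule inner_coroot_sub_root_seq_pullback)

section \<open>Enumeration of the deleted positions\<close>

lemma deleted_pos_mem: "h < num_deleted t \<Delta> \<Longrightarrow> deleted_pos t \<Delta> h \<in> {1..t} - \<Delta>"
  unfolding deleted_pos_def num_deleted_def
  by (metis finite_Diff finite_atLeastAtMost nth_mem sorted_list_of_set.length_sorted_key_list_of_set
      sorted_list_of_set.set_sorted_key_list_of_set)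

lemma deleted_pos_strict_mono:
  "h < l \<Longrightarrow> l < num_deleted t \<Delta> \<Longrightarrow> deleted_pos t \<Delta> h < deleted_pos t \<Delta> l"
  unfolding deleted_pos_def num_deleted_def
  by (rule sorted_wrt_nth_less[OF sorted_list_of_set.strict_sorted_key_list_of_set]) auto

lemma deleted_pos_surj:
  assumes "k \<in> {1..t} - \<Delta>"
  obtains h where "h < num_deleted t \<Delta>" "k = deleted_pos t \<Delta> h"
proof -
  have "k \<in> set (sorted_list_of_set ({1..t} - \<Delta>))" using assms by simp
  then obtain h where "h < num_deleted t \<Delta>" "sorted_list_of_set ({1..t} - \<Delta>) ! h = k"
    unfolding in_set_conv_nth num_deleted_def by auto
  then show ?thesis using that by (simp add: deleted_pos_def)
qed

lemma inj_on_deleted_pos: "inj_on (deleted_pos t \<Delta>) {..<num_deleted t \<Delta>}"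
  by (rule inj_onI) (metis deleted_pos_strict_mono lessThan_iff linorder_neqE_nat nat_less_le)

lemma sum_deleted_pos:
  "sum g ({1..t} - \<Delta>) = (\<Sum>h<num_deleted t \<Delta>. g (deleted_pos t \<Delta> h))"
proof -
  have "{1..t} - \<Delta> = deleted_pos t \<Delta> ` {..<num_deleted t \<Delta>}"
  proof (intro equalityI subsetI)
    fix k assume "k \<in> {1..t} - \<Delta>"
    then show "k \<in> deleted_pos t \<Delta> ` {..<num_deleted t \<Delta>}"
      by (rule deleted_pos_surj) simp
  qed (use deleted_pos_mem in blast)
  then show ?thesis by (simp add: sum.reindex inj_on_deleted_pos)
qed

lemma sum_deleted_pos_below:
  assumes "h < num_deleted t \<Delta>"
  shows "sum g ({1..deleted_pos t \<Delta> h - 1} - \<Delta>) = (\<Sum>j<h. g (deleted_pos t \<Delta> j))"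
proof -
  let ?p = "deleted_pos t \<Delta>"
  have "{1..?p h - 1} - \<Delta> = ?p ` {..<h}"
  proof (intro equalityI subsetI)
    fix k assume k: "k \<in> {1..?p h - 1} - \<Delta>"
    then have "k \<in> {1..t} - \<Delta>" using deleted_pos_mem[OF assms] by auto
    then obtain j where j: "j < num_deleted t \<Delta>" "k = ?p j" by (rule deleted_pos_surj)
    have "?p j < ?p h" using k j by auto
    then have "j < h"
      using deleted_pos_strict_mono[of h j t \<Delta>] j(1) by (metis linorder_neqE_nat not_less_iff_gr_or_eq)
    then show "k \<in> ?p ` {..<h}" using j by auto
  next
    fix k assume "k \<in> ?p ` {..<h}"
    then obtain j where j: "j < h" "k = ?p j" by auto
    then show "k \<in> {1..?p h - 1} - \<Delta>"
      using deleted_pos_mem[of j t \<Delta>] deleted_pos_strict_mono[of j h t \<Delta>] assms by auto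
  qed
  moreover have "inj_on ?p {..<h}"
    using inj_on_deleted_pos by (rule inj_on_subset) (use assms in auto)
  ultimately show ?thesis by (simp add: sum.reindex)
qed

section \<open>The skew-symmetric matrix and the maps between the two kernels\<close>

lemma skew_mat_carrier [simp]:
  "skew_mat \<alpha> i t \<Delta> \<in> carrier_mat (num_deleted t \<Delta>) (num_deleted t \<Delta>)"
  by (simp add: skew_mat_def)

lemma dim_skew_mat [simp]:
  "dim_row (skew_mat \<alpha> i t \<Delta>) = num_deleted t \<Delta>" "dim_col (skew_mat \<alpha> i t \<Delta>) = num_deleted t \<Delta>"
  by (simp_all add: skew_mat_def)

lemma sum_split_at:
  fixes g :: "nat \<Rightarrow> 'b::ab_group_add"
  assumes "h < m"
  shows "sum g {..<m} = sum g {..<h} + g h + sum g {h<..<m}"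
proof -
  have "{..<m} = insert h ({..<h} \<union> {h<..<m})" using assms by auto
  moreover have "sum g ({..<h} \<union> {h<..<m}) = sum g {..<h} + sum g {h<..<m}"
    by (rule sum.union_disjoint) auto
  ultimately show ?thesis by (simp add: add_ac)
qed

lemma skew_mat_mult_index:
  fixes \<alpha> :: "nat \<Rightarrow> 'a::euclidean_space" and i :: "nat \<Rightarrow> nat"
  assumes "v \<in> carrier_vec (num_deleted t \<Delta>)" "h < num_deleted t \<Delta>"
  defines "b \<equiv> \<lambda>h. root_seq \<alpha> i (deleted_pos t \<Delta> h)"
  shows "(skew_mat \<alpha> i t \<Delta> *\<^sub>v v) $ h =
    inner (b h) ((\<Sum>l\<in>{h<..<num_deleted t \<Delta>}. v $ l *\<^sub>R b l) - (\<Sum>l<h. v $ l *\<^sub>R b l))"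
proof -
  let ?m = "num_deleted t \<Delta>"
  have "(skew_mat \<alpha> i t \<Delta> *\<^sub>v v) $ h = (\<Sum>l<?m. skew_mat \<alpha> i t \<Delta> $$ (h, l) * v $ l)"
    using assms(1,2) by (simp add: scalar_prod_def atLeast0LessThan)
  also have "\<dots> = (\<Sum>l<h. - inner (b l) (b h) * v $ l) + 0 + (\<Sum>l\<in>{h<..<?m}. inner (b h) (b l) * v $ l)"
    unfolding sum_split_at[OF assms(2)] using assms(2)
    by (intro arg_cong2[of _ _ _ _ plus] sum.cong) (auto simp: skew_mat_def b_def Let_def)
  finally show ?thesis
    by (simp add: inner_diff_right inner_sum_right sum_negf inner_commute mult.commute)
qed

text \<open>
  In the difference, the terms above \<open>h\<close> keep the factor \<open>1/2\<close>, those below get \<open>-1/2\<close>, and the term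
  at \<open>h\<close> contributes \<open>v h\<close> because \<open>b h\<close> pairs with its coroot to \<open>2\<close>. By
  \<open>skew_mat_mult_index\<close> the inner product in the remainder is an entry of the skew-symmetric matrix
  applied to \<open>v\<close>.
\<close>
lemma inner_coroot_half_sum:
  fixes h m :: nat
  assumes "h < m" "b h \<noteq> 0"
  shows "inner (coroot (b h)) ((1/2) *\<^sub>R (\<Sum>j<m. v j *\<^sub>R b j) - (\<Sum>j<h. v j *\<^sub>R b j)) =
    v h + inner (b h) ((\<Sum>l\<in>{h<..<m}. v l *\<^sub>R b l) - (\<Sum>l<h. v l *\<^sub>R b l)) / inner (b h) (b h)"
proof -
  let ?lo = "\<Sum>j<h. v j *\<^sub>R b j" and ?hi = "\<Sum>l\<in>{h<..<m}. v l *\<^sub>R b l"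
  have "(1/2) *\<^sub>R (\<Sum>j<m. v j *\<^sub>R b j) = (1/2) *\<^sub>R ?lo + (1/2) *\<^sub>R (v h *\<^sub>R b h) + (1/2) *\<^sub>R ?hi"
    unfolding sum_split_at[OF assms(1)] by (simp add: algebra_simps)
  moreover have "inner (b h) (b h) \<noteq> 0" using assms(2) by simp
  ultimately show ?thesis
    by (simp add: coroot_def inner_add_right inner_diff_right field_simps)
qed

lemma dim_Psi [simp]: "dim_vec (Psi \<alpha> i t \<Delta> \<gamma>) = num_deleted t \<Delta>"
  by (simp add: Psi_def)

text \<open>
  The recursion involves only the roots of the full word at the deleted positions, which are also
  the roots that define the matrix; this is what links the kernel of the matrix to \<open>\<Psi>\<close>.
\<close>
lemma Psi_recursion:
  fixes \<alpha> :: "nat \<Rightarrow> 'a::euclidean_space" and i :: "nat \<Rightarrow> nat"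
  assumes "h < num_deleted t \<Delta>"
  defines "b \<equiv> \<lambda>h. root_seq \<alpha> i (deleted_pos t \<Delta> h)"
  shows "Psi \<alpha> i t \<Delta> \<gamma> $ h =
    inner (coroot (b h)) (sub_prod \<alpha> i \<Delta> t \<gamma> - (\<Sum>j<h. Psi \<alpha> i t \<Delta> \<gamma> $ j *\<^sub>R b j))"
proof -
  have "(\<Sum>j<h. Psi \<alpha> i t \<Delta> \<gamma> $ j *\<^sub>R b j) =
     (\<Sum>j<h. inner (coroot (sub_root_seq \<alpha> i \<Delta> (deleted_pos t \<Delta> j))) (sub_prod \<alpha> i \<Delta> t \<gamma>) *\<^sub>R b j)"
    using assms(1) by (intro sum.cong) (auto simp: Psi_def)
  then show ?thesis
    using inner_coroot_sub_root_seq[of \<alpha> i \<Delta> "deleted_pos t \<Delta> h" "sub_prod \<alpha> i \<Delta> t \<gamma>"] assms(1)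
    unfolding sum_deleted_pos_below[OF assms(1)] by (simp add: Psi_def b_def)
qed

lemma word_prod_eq_sub_prod_minus_Psi:
  "word_prod \<alpha> i t \<gamma> = sub_prod \<alpha> i \<Delta> t \<gamma> -
     (\<Sum>h<num_deleted t \<Delta>. Psi \<alpha> i t \<Delta> \<gamma> $ h *\<^sub>R root_seq \<alpha> i (deleted_pos t \<Delta> h))"
  using word_prod_inv_sub_prod[of \<alpha> i t \<Delta> "sub_prod \<alpha> i \<Delta> t \<gamma>"]
  unfolding sum_deleted_pos by (simp add: Psi_def)

lemma Phi_eq:
  "Phi \<alpha> i t \<Delta> v = inv_into UNIV (sub_prod \<alpha> i \<Delta> t)
     ((1/2) *\<^sub>R (\<Sum>h<num_deleted t \<Delta>. v $ h *\<^sub>R root_seq \<alpha> i (deleted_pos t \<Delta> h)))"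
proof -
  have lin: "linear (inv_into UNIV (sub_prod \<alpha> i \<Delta> t))"
    by (simp add: orthogonal_transformation_linear orthogonal_transformation_inv
        orthogonal_transformation_sub_prod)
  show ?thesis
    by (simp add: Phi_def linear_cmul[OF lin] linear_sum[OF lin] scaleR_sum_right mult.commute)
qed

lemma sub_prod_Phi:
  "sub_prod \<alpha> i \<Delta> t (Phi \<alpha> i t \<Delta> v) =
     (1/2) *\<^sub>R (\<Sum>h<num_deleted t \<Delta>. v $ h *\<^sub>R root_seq \<alpha> i (deleted_pos t \<Delta> h))"
  by (simp add: Phi_eq)

lemma sub_prod_eq_half_sum_Psi:
  assumes "word_prod \<alpha> i t \<gamma> + sub_prod \<alpha> i \<Delta> t \<gamma> = 0"
  shows "sub_prod \<alpha> i \<Delta> t \<gamma> =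
    (1/2) *\<^sub>R (\<Sum>h<num_deleted t \<Delta>. Psi \<alpha> i t \<Delta> \<gamma> $ h *\<^sub>R root_seq \<alpha> i (deleted_pos t \<Delta> h))"
proof -
  have "2 *\<^sub>R sub_prod \<alpha> i \<Delta> t \<gamma> =
    (\<Sum>h<num_deleted t \<Delta>. Psi \<alpha> i t \<Delta> \<gamma> $ h *\<^sub>R root_seq \<alpha> i (deleted_pos t \<Delta> h))"
    using assms by (simp add: word_prod_eq_sub_prod_minus_Psi[of \<alpha> i t \<gamma> \<Delta>] scaleR_2 algebra_simps)
  from this[symmetric] show ?thesis by simp
qed

lemma Phi_Psi:
  assumes "word_prod \<alpha> i t \<gamma> + sub_prod \<alpha> i \<Delta> t \<gamma> = 0"
  shows "Phi \<alpha> i t \<Delta> (Psi \<alpha> i t \<Delta> \<gamma>) = \<gamma>"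
  unfolding Phi_eq sub_prod_eq_half_sum_Psi[OF assms, symmetric] by simp

lemma skew_mat_Psi_eq_0:
  assumes "word_prod \<alpha> i t \<gamma> + sub_prod \<alpha> i \<Delta> t \<gamma> = 0"
    and nz: "\<And>h. h < num_deleted t \<Delta> \<Longrightarrow> root_seq \<alpha> i (deleted_pos t \<Delta> h) \<noteq> 0"
  shows "skew_mat \<alpha> i t \<Delta> *\<^sub>v Psi \<alpha> i t \<Delta> \<gamma> = 0\<^sub>v (num_deleted t \<Delta>)"
proof (rule eq_vecI)
  let ?c = "Psi \<alpha> i t \<Delta> \<gamma>" and ?b = "\<lambda>h. root_seq \<alpha> i (deleted_pos t \<Delta> h)"
  fix h assume "h < dim_vec (0\<^sub>v (num_deleted t \<Delta>) :: real vec)"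
  then have h: "h < num_deleted t \<Delta>" by simp
  have "?c \<in> carrier_vec (num_deleted t \<Delta>)" by (simp add: carrier_dim_vec)
  note idx = skew_mat_mult_index[OF this h, of \<alpha> i]
  have "?c $ h = inner (coroot (?b h)) (sub_prod \<alpha> i \<Delta> t \<gamma> - (\<Sum>j<h. ?c $ j *\<^sub>R ?b j))"
    by (rule Psi_recursion[OF h])
  also have "\<dots> = ?c $ h + (skew_mat \<alpha> i t \<Delta> *\<^sub>v ?c) $ h / inner (?b h) (?b h)"
    unfolding idx using inner_coroot_half_sum[of h _ ?b "\<lambda>h. ?c $ h", OF h nz[OF h]]
    by (subst sub_prod_eq_half_sum_Psi[OF assms(1)])
  finally have "?c $ h = ?c $ h + (skew_mat \<alpha> i t \<Delta> *\<^sub>v ?c) $ h / inner (?b h) (?b h)" .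
  then show "(skew_mat \<alpha> i t \<Delta> *\<^sub>v ?c) $ h = 0\<^sub>v (num_deleted t \<Delta>) $ h"
    using h nz[OF h] by simp
qed simp

text \<open>
  For \<open>v\<close> in the kernel, the vector \<open>v\<close> itself solves the recursion of \<open>\<Psi>(\<Phi>(v))\<close>, so the two
  agree entry by entry.
\<close>
lemma Psi_Phi:
  assumes v: "v \<in> carrier_vec (num_deleted t \<Delta>)"
    and ker: "skew_mat \<alpha> i t \<Delta> *\<^sub>v v = 0\<^sub>v (num_deleted t \<Delta>)"
    and nz: "\<And>h. h < num_deleted t \<Delta> \<Longrightarrow> root_seq \<alpha> i (deleted_pos t \<Delta> h) \<noteq> 0"
  shows "Psi \<alpha> i t \<Delta> (Phi \<alpha> i t \<Delta> v) = v"
proof (rule eq_vecI)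
  let ?c = "Psi \<alpha> i t \<Delta> (Phi \<alpha> i t \<Delta> v)" and ?b = "\<lambda>h. root_seq \<alpha> i (deleted_pos t \<Delta> h)"
  have "?c $ h = v $ h" if "h < num_deleted t \<Delta>" for h
    using that
  proof (induction h rule: less_induct)
    case (less h)
    have "(\<Sum>j<h. ?c $ j *\<^sub>R ?b j) = (\<Sum>j<h. v $ j *\<^sub>R ?b j)"
      using less by (intro sum.cong) auto
    then have "?c $ h = v $ h + (skew_mat \<alpha> i t \<Delta> *\<^sub>v v) $ h / inner (?b h) (?b h)"
      using Psi_recursion[OF less.prems, of \<alpha> i "Phi \<alpha> i t \<Delta> v"]
        inner_coroot_half_sum[of h "num_deleted t \<Delta>" ?b "\<lambda>h. v $ h", OF less.prems nz[OF less.prems]]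
      by (simp only: skew_mat_mult_index[OF v less.prems] sub_prod_Phi)
    then show ?case using less.prems by (simp add: ker)
  qed
  then show "?c $ h = v $ h" if "h < dim_vec v" for h using that v by simp
qed (use v in simp)

lemma word_prod_plus_sub_prod_Phi:
  fixes \<alpha> :: "nat \<Rightarrow> 'a::euclidean_space"
  assumes "v \<in> carrier_vec (num_deleted t \<Delta>)"
    and "skew_mat \<alpha> i t \<Delta> *\<^sub>v v = 0\<^sub>v (num_deleted t \<Delta>)"
    and "\<And>h. h < num_deleted t \<Delta> \<Longrightarrow> root_seq \<alpha> i (deleted_pos t \<Delta> h) \<noteq> 0"
  shows "word_prod \<alpha> i t (Phi \<alpha> i t \<Delta> v) + sub_prod \<alpha> i \<Delta> t (Phi \<alpha> i t \<Delta> v) = 0"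
proof -
  have "(1/2) *\<^sub>R y - y + (1/2) *\<^sub>R y = 0" for y :: 'a
    by (simp add: algebra_simps flip: scaleR_add_left)
  then show ?thesis
    using word_prod_eq_sub_prod_minus_Psi[of \<alpha> i t "Phi \<alpha> i t \<Delta> v" \<Delta>]
    by (simp only: Psi_Phi[OF assms] sub_prod_Phi)
qed

lemma Phi_add:
  assumes "u \<in> carrier_vec (num_deleted t \<Delta>)" "v \<in> carrier_vec (num_deleted t \<Delta>)"
  shows "Phi \<alpha> i t \<Delta> (u + v) = Phi \<alpha> i t \<Delta> u + Phi \<alpha> i t \<Delta> v"
  using assms by (simp add: Phi_def scaleR_add_left add_divide_distrib sum.distrib)

lemma Phi_smult:
  assumes "v \<in> carrier_vec (num_deleted t \<Delta>)"
  shows "Phi \<alpha> i t \<Delta> (q \<cdot>\<^sub>v v) = q *\<^sub>R Phi \<alpha> i t \<Delta> v"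
  using assms by (simp add: Phi_def scaleR_sum_right)

lemma Phi_unit_vec:
  assumes "h < num_deleted t \<Delta>"
  shows "Phi \<alpha> i t \<Delta> (unit_vec (num_deleted t \<Delta>) h) =
    (1/2) *\<^sub>R inv_into UNIV (sub_prod \<alpha> i \<Delta> t) (root_seq \<alpha> i (deleted_pos t \<Delta> h))"
proof -
  let ?m = "num_deleted t \<Delta>"
    and ?r = "\<lambda>j. (1/2) *\<^sub>R inv_into UNIV (sub_prod \<alpha> i \<Delta> t) (root_seq \<alpha> i (deleted_pos t \<Delta> j))"
  have "Phi \<alpha> i t \<Delta> (unit_vec ?m h) = (\<Sum>j<?m. if j = h then ?r j else 0)"
    unfolding Phi_def by (rule sum.cong) (use assms in auto)
  also have "\<dots> = ?r h" using assms by (subst sum.delta) auto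
  finally show ?thesis .
qed

section \<open>Rationality\<close>

text \<open>
  A root not orthogonal to a root of rational squared length has rational squared length itself:
  both Cartan integers are nonzero, and they express the common inner product through either
  length. Irreducibility spreads this from a short root, of squared length \<open>2\<close>, to all roots.
\<close>
lemma inner_self_root_rational:
  assumes irr: "irreducible_root_system R" and short: "short_roots_normalised R" and r: "r \<in> R"
  shows "inner r r \<in> \<rat>"
proof (rule ccontr)
  assume contra: "inner r r \<notin> \<rat>"
  have rs: "root_system R" using irr by (simp add: irreducible_root_system_def)
  have fin: "finite R" and int: "\<And>a b. a \<in> R \<Longrightarrow> b \<in> R \<Longrightarrow> inner b (coroot a) \<in> \<int>"
    using rs by (auto simp: root_system_def)
  define A where "A = {a \<in> R. inner a a \<in> \<rat>}"
  have "Min (norm ` R) \<in> norm ` R" using fin r by (intro Min_in) auto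
  then obtain s where s: "s \<in> R" "norm s = sqrt 2"
    using short by (auto simp: short_roots_normalised_def)
  have "inner s s = 2" using s(2) by (simp add: norm_eq_sqrt_inner)
  then have "A \<noteq> {}" using s(1) by (auto simp: A_def)
  moreover have "A \<union> (R - A) = R" "A \<inter> (R - A) = {}" by (auto simp: A_def)
  moreover have "R - A \<noteq> {}" using r contra by (auto simp: A_def)
  moreover have "\<forall>a\<in>A. \<forall>b\<in>R - A. inner a b = 0"
  proof (intro ballI, rule ccontr)
    fix a b assume a: "a \<in> A" and b: "b \<in> R - A" and nz: "inner a b \<noteq> 0"
    have aR: "a \<in> R" "inner a a \<in> \<rat>" and bR: "b \<in> R" "inner b b \<notin> \<rat>"
      using a b by (auto simp: A_def)
    have nz': "inner a a \<noteq> 0" "inner b b \<noteq> 0" using nz by auto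
    have "inner b (coroot a) \<in> \<rat>" "inner a (coroot b) \<in> \<rat>"
      using int aR bR Ints_subset_Rats by blast+
    \<comment> \<open>Numerator and denominator are \<open>2 \<langle>a | b\<rangle>\<close> and \<open>2 \<langle>a | b\<rangle> / \<langle>b | b\<rangle>\<close>.\<close>
    then have "inner b (coroot a) * inner a a / inner a (coroot b) \<in> \<rat>"
      using aR(2) by (intro Rats_divide Rats_mult) auto
    moreover have "inner b (coroot a) * inner a a / inner a (coroot b) = inner b b"
      using nz nz' by (simp add: coroot_def inner_commute)
    ultimately show False using bR(2) by simp
  qed
  ultimately show False
    using irr unfolding irreducible_root_system_def by metis
qed

lemma inner_roots_rational:
  assumes irr: "irreducible_root_system R" and short: "short_roots_normalised R"
    and a: "a \<in> R" and b: "b \<in> R"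
  shows "inner a b \<in> \<rat>"
proof -
  have "inner b (coroot a) \<in> \<int>" and "a \<noteq> 0"
    using irr a b by (auto simp: irreducible_root_system_def root_system_def)
  then have "inner b (coroot a) * inner a a / 2 \<in> \<rat>"
    using inner_self_root_rational[OF irr short a] Ints_subset_Rats
    by (intro Rats_divide Rats_mult) auto
  moreover have "inner b (coroot a) * inner a a / 2 = inner a b"
    using \<open>a \<noteq> 0\<close> by (simp add: coroot_def inner_commute)
  ultimately show ?thesis by simp
qed

lemma word_prod_root:
  assumes "root_system R" "simple_roots R n \<alpha>" "\<forall>j\<in>{1..k}. i j \<in> {1..n}" "r \<in> R"
  shows "word_prod \<alpha> i k r \<in> R"
  using assms(3,4)
proof (induction k arbitrary: r)
  case (Suc k)
  then have "\<alpha> (i (Suc k)) \<in> R" using assms(2) by (auto simp: simple_roots_def)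
  then have "reflection (\<alpha> (i (Suc k))) r \<in> R"
    using assms(1) Suc.prems(2) unfolding root_system_def by blast
  then show ?case using Suc by simp
qed simp

lemma root_seq_root:
  assumes "root_system R" "simple_roots R n \<alpha>" "\<forall>j\<in>{1..t}. i j \<in> {1..n}" "k \<in> {1..t}"
  shows "root_seq \<alpha> i k \<in> R"
proof -
  have "\<alpha> (i k) \<in> R" using assms by (auto simp: simple_roots_def)
  then show ?thesis
    unfolding root_seq_def using assms by (intro word_prod_root[OF assms(1,2)]) auto
qed

text \<open>
  The simple coroots are dual to the fundamental weights, so they read off the coordinates of a
  vector; a vector orthogonal to all of them is zero because the simple roots span.
\<close>
lemma rat_weight_space_iff:
  assumes simple: "simple_roots R n \<alpha>" and fw: "fundamental_weights n \<alpha> \<omega>"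
  shows "x \<in> rat_weight_space n \<omega> \<longleftrightarrow> (\<forall>k\<in>{1..n}. inner x (coroot (\<alpha> k)) \<in> \<rat>)"
proof -
  have coord: "inner (\<Sum>j=1..n. q j *\<^sub>R \<omega> j) (coroot (\<alpha> k)) = q k" if k: "k \<in> {1..n}" for q k
  proof -
    have "inner (\<Sum>j=1..n. q j *\<^sub>R \<omega> j) (coroot (\<alpha> k)) = (\<Sum>j=1..n. if j = k then q j else 0)"
      unfolding inner_sum_left
      by (rule sum.cong) (use fw k in \<open>auto simp: fundamental_weights_def\<close>)
    then show ?thesis using k by simp
  qed
  show ?thesis
  proof
    assume "x \<in> rat_weight_space n \<omega>"
    then show "\<forall>k\<in>{1..n}. inner x (coroot (\<alpha> k)) \<in> \<rat>"
      unfolding rat_weight_space_def by (auto simp only: coord)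
  next
    assume rat: "\<forall>k\<in>{1..n}. inner x (coroot (\<alpha> k)) \<in> \<rat>"
    define d where "d = x - (\<Sum>j=1..n. inner x (coroot (\<alpha> j)) *\<^sub>R \<omega> j)"
    have "orthogonal d y" if y: "y \<in> \<alpha> ` {1..n}" for y
    proof -
      obtain k where k: "k \<in> {1..n}" "y = \<alpha> k" using y by blast
      have "inner d (coroot (\<alpha> k)) = 0"
        unfolding d_def inner_diff_left using k(1) by (simp only: coord)
      then show ?thesis using k(2) by (auto simp: coroot_def orthogonal_def)
    qed
    then have "orthogonal d d"
      using simple by (intro orthogonal_to_span[of d "\<alpha> ` {1..n}"]) (auto simp: simple_roots_def)
    then have "x = (\<Sum>j=1..n. inner x (coroot (\<alpha> j)) *\<^sub>R \<omega> j)" by (simp add: d_def orthogonal_def)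
    then show "x \<in> rat_weight_space n \<omega>"
      unfolding rat_weight_space_def using rat
      by (intro CollectI exI[of _ "\<lambda>j. inner x (coroot (\<alpha> j))"] conjI)
  qed
qed

context
  fixes R :: "'a::euclidean_space set" and n :: nat and \<alpha> \<omega> :: "nat \<Rightarrow> 'a"
  assumes rs: "root_system R"
    and simple: "simple_roots R n \<alpha>"
    and fw: "fundamental_weights n \<alpha> \<omega>"
begin

lemma rat_weight_space_add:
  "x \<in> rat_weight_space n \<omega> \<Longrightarrow> y \<in> rat_weight_space n \<omega> \<Longrightarrow> x + y \<in> rat_weight_space n \<omega>"
  by (simp add: rat_weight_space_iff[OF simple fw] inner_add_left)

lemma rat_weight_space_scaleR:
  "q \<in> \<rat> \<Longrightarrow> x \<in> rat_weight_space n \<omega> \<Longrightarrow> q *\<^sub>R x \<in> rat_weight_space n \<omega>"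
  by (simp add: rat_weight_space_iff[OF simple fw])

lemma rat_weight_space_sum:
  "(\<And>j. j \<in> A \<Longrightarrow> g j \<in> rat_weight_space n \<omega>) \<Longrightarrow> sum g A \<in> rat_weight_space n \<omega>"
  by (auto simp: rat_weight_space_iff[OF simple fw] inner_sum_left intro!: Rats_sum)

lemma rat_weight_space_root:
  assumes "r \<in> R"
  shows "r \<in> rat_weight_space n \<omega>"
proof -
  have "inner r (coroot (\<alpha> k)) \<in> \<int>" if "k \<in> {1..n}" for k
    using rs simple assms that unfolding root_system_def simple_roots_def by blast
  then show ?thesis
    using Ints_subset_Rats by (auto simp: rat_weight_space_iff[OF simple fw])
qed

lemma rat_weight_space_reflection:
  assumes "k \<in> {1..n}" "x \<in> rat_weight_space n \<omega>"
  shows "reflection (\<alpha> k) x \<in> rat_weight_space n \<omega>"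
proof -
  have "\<alpha> k \<in> R" using simple assms(1) by (auto simp: simple_roots_def)
  moreover have "- inner x (coroot (\<alpha> k)) \<in> \<rat>"
    using assms rat_weight_space_iff[OF simple fw] by simp
  ultimately have "x + (- inner x (coroot (\<alpha> k))) *\<^sub>R \<alpha> k \<in> rat_weight_space n \<omega>"
    by (intro rat_weight_space_add rat_weight_space_scaleR rat_weight_space_root assms(2))
  then show ?thesis by (simp add: reflection_def)
qed

lemma rat_weight_space_word_prod:
  assumes "\<forall>j\<in>{1..k}. i j \<in> {1..n}" "x \<in> rat_weight_space n \<omega>"
  shows "word_prod \<alpha> i k x \<in> rat_weight_space n \<omega>"
  using assms by (induction k arbitrary: x) (simp_all add: rat_weight_space_reflection)

lemma rat_weight_space_sub_prod:
  assumes "\<forall>j\<in>{1..k}. i j \<in> {1..n}" "x \<in> rat_weight_space n \<omega>"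
  shows "sub_prod \<alpha> i \<Delta> k x \<in> rat_weight_space n \<omega>"
  using assms by (induction k arbitrary: x) (simp_all add: rat_weight_space_reflection)

lemma rat_weight_space_inv_sub_prod:
  assumes "\<forall>j\<in>{1..k}. i j \<in> {1..n}" "x \<in> rat_weight_space n \<omega>"
  shows "inv_into UNIV (sub_prod \<alpha> i \<Delta> k) x \<in> rat_weight_space n \<omega>"
  using assms
proof (induction k)
  case 0
  then show ?case by (simp add: inv_id)
next
  case (Suc k)
  then show ?case
    by (simp add: inv_sub_prod_Suc rat_weight_space_reflection del: sub_prod.simps)
qed

lemma Phi_rat_weight_space:
  assumes "\<forall>j\<in>{1..t}. i j \<in> {1..n}" "v \<in> rat_vecs (num_deleted t \<Delta>)"
  shows "Phi \<alpha> i t \<Delta> v \<in> rat_weight_space n \<omega>"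
  unfolding Phi_def
proof (rule rat_weight_space_sum)
  fix h assume "h \<in> {..<num_deleted t \<Delta>}"
  then have h: "h < num_deleted t \<Delta>" by simp
  have "root_seq \<alpha> i (deleted_pos t \<Delta> h) \<in> R"
    using root_seq_root[OF rs simple assms(1)] deleted_pos_mem[OF h] by blast
  then show "v $ h *\<^sub>R ((1/2) *\<^sub>R inv_into UNIV (sub_prod \<alpha> i \<Delta> t) (root_seq \<alpha> i (deleted_pos t \<Delta> h)))
      \<in> rat_weight_space n \<omega>"
    using assms h
    by (intro rat_weight_space_scaleR rat_weight_space_inv_sub_prod rat_weight_space_root)
      (auto simp: rat_vecs_def)
qed

lemma Psi_rat_vecs:
  assumes "\<forall>j\<in>{1..t}. i j \<in> {1..n}" "\<gamma> \<in> rat_weight_space n \<omega>"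
  shows "Psi \<alpha> i t \<Delta> \<gamma> \<in> rat_vecs (num_deleted t \<Delta>)"
proof -
  have "inner (coroot (sub_root_seq \<alpha> i \<Delta> k)) (sub_prod \<alpha> i \<Delta> t \<gamma>) \<in> \<rat>" if k: "k \<in> {1..t}" for k
  proof -
    let ?y = "inv_into UNIV (sub_prod \<alpha> i \<Delta> (k - 1)) (sub_prod \<alpha> i \<Delta> t \<gamma>)"
    have "?y \<in> rat_weight_space n \<omega>"
      using assms k by (intro rat_weight_space_inv_sub_prod rat_weight_space_sub_prod) auto
    then have "inner ?y (coroot (\<alpha> (i k))) \<in> \<rat>"
      using rat_weight_space_iff[OF simple fw] assms(1) k by blast
    then show ?thesis by (simp add: inner_coroot_sub_root_seq_pullback inner_commute)
  qed
  then have "Psi \<alpha> i t \<Delta> \<gamma> $ h \<in> \<rat>" if "h < num_deleted t \<Delta>" for h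
    using deleted_pos_mem[OF that] that by (simp add: Psi_def)
  then show ?thesis
    unfolding rat_vecs_def by (intro CollectI conjI allI impI carrier_vecI) simp_all
qed

end

lemma skew_mat_mult_rat_vecs:
  assumes irr: "irreducible_root_system R" and short: "short_roots_normalised R"
    and simple: "simple_roots R n \<alpha>" and i: "\<forall>j\<in>{1..t}. i j \<in> {1..n}"
    and v: "v \<in> rat_vecs (num_deleted t \<Delta>)"
  shows "skew_mat \<alpha> i t \<Delta> *\<^sub>v v \<in> rat_vecs (num_deleted t \<Delta>)"
proof -
  let ?b = "\<lambda>h. root_seq \<alpha> i (deleted_pos t \<Delta> h)"
  have "root_system R" using irr by (simp add: irreducible_root_system_def)
  then have root: "?b h \<in> R" if "h < num_deleted t \<Delta>" for h
    using root_seq_root[OF _ simple i] deleted_pos_mem[OF that] by blast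
  have "(skew_mat \<alpha> i t \<Delta> *\<^sub>v v) $ h \<in> \<rat>" if h: "h < num_deleted t \<Delta>" for h
  proof -
    have vc: "v \<in> carrier_vec (num_deleted t \<Delta>)" using v by (simp add: rat_vecs_def)
    show ?thesis
      unfolding skew_mat_mult_index[OF vc h] inner_diff_right inner_sum_right inner_scaleR_right
      using v h
      by (intro Rats_diff Rats_sum Rats_mult inner_roots_rational[OF irr short] root)
        (auto simp: rat_vecs_def)
  qed
  then show ?thesis
    unfolding rat_vecs_def by (intro CollectI conjI allI impI carrier_vecI) simp_all
qed

section \<open>The kernels are isomorphic\<close>

theorem theorem3p7:
  fixes R :: "'a::euclidean_space set"
    and n t :: nat
    and \<alpha> \<omega> :: "nat \<Rightarrow> 'a"
    and w w\<^sub>\<Delta> :: "'a \<Rightarrow> 'a"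
    and i :: "nat \<Rightarrow> nat"
    and \<Delta> :: "nat set"
    and m :: nat
    and V :: "'a set"
  assumes "irreducible_root_system R"
    and "short_roots_normalised R"
    and "simple_roots R n \<alpha>"
    and "fundamental_weights n \<alpha> \<omega>"
    and "w \<in> weyl_group n \<alpha>"
    and "reduced_decomposition n \<alpha> w i t"
    and "\<Delta> \<subseteq> {1..t}"
    and "w\<^sub>\<Delta> = sub_prod \<alpha> i \<Delta> t"
    and "m = num_deleted t \<Delta>"
    and "V = rat_weight_space n \<omega>"
  shows
    \<comment> \<open>\<open>M(w\<^sub>\<Delta>)\<close>, \<open>w + w\<^sub>\<Delta>\<close> and \<open>\<Phi>\<close> are linear maps between the stated rational spaces\<close>
    "rat_linear_map (\<cdot>\<^sub>v) (\<cdot>\<^sub>v) (rat_vecs m) (rat_vecs m) (\<lambda>v. skew_mat \<alpha> i t \<Delta> *\<^sub>v v)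
     \<and> rat_linear_map (*\<^sub>R) (*\<^sub>R) V V (\<lambda>\<gamma>. w \<gamma> + w\<^sub>\<Delta> \<gamma>)
     \<and> rat_linear_map (\<cdot>\<^sub>v) (*\<^sub>R) (rat_vecs m) V (Phi \<alpha> i t \<Delta>)
     \<and> (\<forall>h<m. Phi \<alpha> i t \<Delta> (unit_vec m h) =
              (1 / 2) *\<^sub>R inv_into UNIV w\<^sub>\<Delta> (root_seq \<alpha> i (deleted_pos t \<Delta> h)))
     \<and> (\<forall>\<gamma>\<in>ker_sum n \<omega> w w\<^sub>\<Delta>. Psi \<alpha> i t \<Delta> \<gamma> \<in> ker_skew \<alpha> i t \<Delta>)
     \<and> rat_linear_map (\<cdot>\<^sub>v) (*\<^sub>R) (ker_skew \<alpha> i t \<Delta>) (ker_sum n \<omega> w w\<^sub>\<Delta>) (Phi \<alpha> i t \<Delta>)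
     \<and> (\<forall>v\<in>ker_skew \<alpha> i t \<Delta>. Psi \<alpha> i t \<Delta> (Phi \<alpha> i t \<Delta> v) = v)
     \<and> (\<forall>\<gamma>\<in>ker_sum n \<omega> w w\<^sub>\<Delta>. Phi \<alpha> i t \<Delta> (Psi \<alpha> i t \<Delta> \<gamma>) = \<gamma>)"
proof -
  have rs: "root_system R" using assms(1) by (simp add: irreducible_root_system_def)
  have i: "\<forall>j\<in>{1..t}. i j \<in> {1..n}" and w: "w = word_prod \<alpha> i t"
    using assms(6) unfolding reduced_decomposition_def by blast+
  have nz: "root_seq \<alpha> i (deleted_pos t \<Delta> h) \<noteq> 0" if "h < num_deleted t \<Delta>" for h
    using root_seq_root[OF rs assms(3) i deleted_pos_mem[OF that, THEN DiffD1]] rs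
    by (auto simp: root_system_def)
  have ker_skewD: "v \<in> rat_vecs m" "v \<in> carrier_vec (num_deleted t \<Delta>)"
    "skew_mat \<alpha> i t \<Delta> *\<^sub>v v = 0\<^sub>v (num_deleted t \<Delta>)" if "v \<in> ker_skew \<alpha> i t \<Delta>" for v
    using that by (auto simp: ker_skew_def mat_kernel_def assms(9))
  have lin: "linear (word_prod \<alpha> i t)" "linear (sub_prod \<alpha> i \<Delta> t)"
    by (simp_all add: orthogonal_transformation_linear
        orthogonal_transformation_word_prod orthogonal_transformation_sub_prod)
  have carr: "v \<in> carrier_vec (num_deleted t \<Delta>)" if "v \<in> rat_vecs m" for v
    using that by (simp add: rat_vecs_def assms(9))
  have skew: "rat_linear_map (\<cdot>\<^sub>v) (\<cdot>\<^sub>v) (rat_vecs m) (rat_vecs m) (\<lambda>v. skew_mat \<alpha> i t \<Delta> *\<^sub>v v)"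
    unfolding rat_linear_map_def
    using skew_mat_mult_rat_vecs[OF assms(1,2,3) i]
    by (auto simp: assms(9) rat_vecs_def
        intro!: mult_add_distrib_mat_vec[OF skew_mat_carrier] mult_mat_vec[OF skew_mat_carrier])
  have sum: "rat_linear_map (*\<^sub>R) (*\<^sub>R) V V (\<lambda>\<gamma>. w \<gamma> + w\<^sub>\<Delta> \<gamma>)"
    unfolding rat_linear_map_def
    using rat_weight_space_word_prod[OF rs assms(3,4) i]
      rat_weight_space_sub_prod[OF rs assms(3,4) i]
    by (auto simp: lin[THEN linear_add] lin[THEN linear_cmul] algebra_simps
        assms(10) w assms(8) intro!: rat_weight_space_add[OF rs assms(3,4)])
  have Phi: "rat_linear_map (\<cdot>\<^sub>v) (*\<^sub>R) (rat_vecs m) V (Phi \<alpha> i t \<Delta>)"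
    unfolding rat_linear_map_def
    using Phi_rat_weight_space[OF rs assms(3,4) i] carr
    by (auto simp: assms(9,10) Phi_add Phi_smult)
  have ker_sumD: "\<gamma> \<in> rat_weight_space n \<omega>" "word_prod \<alpha> i t \<gamma> + sub_prod \<alpha> i \<Delta> t \<gamma> = 0"
    if "\<gamma> \<in> ker_sum n \<omega> w w\<^sub>\<Delta>" for \<gamma>
    using that by (auto simp: ker_sum_def w assms(8))
  have Psi: "Psi \<alpha> i t \<Delta> \<gamma> \<in> ker_skew \<alpha> i t \<Delta>" if "\<gamma> \<in> ker_sum n \<omega> w w\<^sub>\<Delta>" for \<gamma>
    unfolding ker_skew_def
  proof (rule IntI)
    show "Psi \<alpha> i t \<Delta> \<gamma> \<in> rat_vecs (num_deleted t \<Delta>)"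
      using Psi_rat_vecs[OF rs assms(3,4) i ker_sumD(1)[OF that]] .
    then show "Psi \<alpha> i t \<Delta> \<gamma> \<in> mat_kernel (skew_mat \<alpha> i t \<Delta>)"
      using skew_mat_Psi_eq_0[OF ker_sumD(2)[OF that] nz]
      by (intro mat_kernelI[OF skew_mat_carrier]) (simp_all add: carrier_dim_vec)
  qed
  have Phi_ker: "rat_linear_map (\<cdot>\<^sub>v) (*\<^sub>R) (ker_skew \<alpha> i t \<Delta>) (ker_sum n \<omega> w w\<^sub>\<Delta>) (Phi \<alpha> i t \<Delta>)"
    unfolding rat_linear_map_def
    using Phi_rat_weight_space[OF rs assms(3,4) i] word_prod_plus_sub_prod_Phi[OF _ _ nz] ker_skewD
    by (auto simp: ker_sum_def w assms(8,9) Phi_add Phi_smult)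
  have unit: "\<forall>h<m. Phi \<alpha> i t \<Delta> (unit_vec m h) =
      (1 / 2) *\<^sub>R inv_into UNIV w\<^sub>\<Delta> (root_seq \<alpha> i (deleted_pos t \<Delta> h))"
    unfolding assms(8,9) by (blast intro: Phi_unit_vec)
  show ?thesis
    using skew sum Phi unit Psi Phi_ker Psi_Phi[OF ker_skewD(2,3) nz] Phi_Psi[OF ker_sumD(2)]
    by blast
qed

end
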